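(* Let $G$ be a group satisfying max-n. Then the space $\mathcal{N}(G)$ is scattered. If moreover every quotient of $G$ is residually finite, then $$\mathrm{cb}(G)=\sup\{\mathrm{cb}(G/N)+1\},$$ where $N$ ranges over the infinite normal subgroups of $G$ (with $\sup\emptyset=0$).
   Context: A group satisfies max-n if it has no infinite strictly increasing sequence of normal subgroups. For a discrete group $G$, let $\mathcal{N}(G)$ be the set of normal subgroups of $G$, with the topology of pointwise convergence, i.e. the subspace topology from $\{0,1\}^G$. For a topological space $X$, set $X^{(0)}=X$, $X^{(\alpha+1)}$ = the set of accumulation points (non-isolated points) of the space $X^{(\alpha)}$, and $X^{(\lambda)}=\bigcap_{\beta<\lambda}X^{(\beta)}$ for limit ordinals $\lambda$. $X$ is scattered if $X^{(\alpha)}=\emptyset$ for some ordinal $\alpha$. For $x\in X$, $\mathrm{CB}_X(x)=\sup\{\alpha : x\in X^{(\alpha)}\}$ if this supremum exists (it is then a maximum; it always exists when $X$ is scattered); otherwise $\mathrm{CB}_X(x)=\mathfrak{C}$, a symbol that is not an ordinal. For a group $G$, $\mathrm{cb}(G)=\mathrm{CB}_{\mathcal{N}(G)}(\{1\})$. *)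

theory Defs
  imports "HOL-Analysis.Analysis" "HOL-Algebra.Coset"
begin

section \<open>Ordinals\<close>

text \<open>
  HOL has no type of all ordinals. The type \<open>'o ordinal\<close> consists of the order types of the
  well-orders on subsets of \<open>'o + nat\<close>, i.e. of the ordinals whose cardinality is at most
  \<open>max |'o| \<aleph>\<^sub>0\<close> (the summand \<open>nat\<close> only serves to make the type closed under successors when
  \<open>'o\<close> is finite). It is thus the initial segment of the ordinals below the successor cardinal
  of \<open>max |'o| \<aleph>\<^sub>0\<close>.
\<close>

quotient_type 'o ordinal = "('o + nat) rel" / partial: "\<lambda>r s. (r, s) \<in> ordIso"
proof (rule part_equivpI)
  show "\<exists>r::('o + nat) rel. (r, r) \<in> ordIso"
    using card_of_refl by blast
  show "symp (\<lambda>(r::('o + nat) rel) s. (r, s) \<in> ordIso)"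
    by (rule sympI) (rule ordIso_symmetric)
  show "transp (\<lambda>(r::('o + nat) rel) s. (r, s) \<in> ordIso)"
    by (rule transpI) (rule ordIso_transitive)
qed

instantiation ordinal :: (type) "{zero, ord}"
begin

lift_definition zero_ordinal :: "'o ordinal" is "{}"
  by (simp add: ordIso_reflexive)

lift_definition less_eq_ordinal :: "'o ordinal \<Rightarrow> 'o ordinal \<Rightarrow> bool"
  is "\<lambda>r s. (r, s) \<in> ordLeq"
  by (meson ordIso_ordLeq_trans ordIso_symmetric ordLeq_ordIso_trans)

lift_definition less_ordinal :: "'o ordinal \<Rightarrow> 'o ordinal \<Rightarrow> bool"
  is "\<lambda>r s. (r, s) \<in> ordLess"
  by (meson ordIso_ordLess_trans ordIso_symmetric ordLess_ordIso_trans)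

instance ..

end

lemma ordIso_self_iff: "(r, r) \<in> ordIso \<longleftrightarrow> Well_order r"
proof
  show "Well_order r" if "(r, r) \<in> ordIso"
    using that by (auto simp: ordIso_def)
qed (rule ordIso_reflexive)

instance ordinal :: (type) wellorder
proof
  fix x y z :: "'o ordinal"
  show "x < y \<longleftrightarrow> x \<le> y \<and> \<not> y \<le> x"
  proof transfer
    fix r s :: "('o + nat) rel"
    assume "(r, r) \<in> ordIso" "(s, s) \<in> ordIso"
    then have "Well_order r" "Well_order s" by (simp_all add: ordIso_self_iff)
    then show "(r, s) \<in> ordLess \<longleftrightarrow> (r, s) \<in> ordLeq \<and> (s, r) \<notin> ordLeq"
      using not_ordLeq_iff_ordLess[of r s] ordLess_imp_ordLeq[of r s] by blast
  qed
  show "x \<le> x"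
    by transfer (simp add: ordIso_self_iff ordLeq_reflexive)
  show "x \<le> y \<Longrightarrow> y \<le> z \<Longrightarrow> x \<le> z"
    by transfer (rule ordLeq_transitive)
  show "x \<le> y \<Longrightarrow> y \<le> x \<Longrightarrow> x = y"
    by transfer (rule iffD2[OF ordIso_iff_ordLeq], rule conjI)
  show "x \<le> y \<or> y \<le> x"
    by transfer (simp add: ordIso_self_iff ordLeq_total)
next
  fix P :: "'o ordinal \<Rightarrow> bool" and a :: "'o ordinal"
  assume step: "\<And>x. (\<And>y. y < x \<Longrightarrow> P y) \<Longrightarrow> P x"
  have "wf {(x, y :: 'o ordinal). x < y}"
  proof (rule wf_subset[OF wf_inv_image[OF wf_ordLess, of rep_ordinal]])
    show "{(x, y :: 'o ordinal). x < y} \<subseteq> inv_image ordLess rep_ordinal"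
      by (auto simp: inv_image_def less_ordinal_def)
  qed
  then show "P a"
  proof (induction a rule: wf_induct_rule)
    case (less x)
    show "P x" by (rule step) (rule less, simp)
  qed
qed

text \<open>\<open>Sup\<close> is the least upper bound; in particular \<open>Sup {} = 0\<close>.\<close>

instantiation ordinal :: (type) conditionally_complete_linorder
begin

definition inf_ordinal :: "'o ordinal \<Rightarrow> 'o ordinal \<Rightarrow> 'o ordinal"
  where "inf_ordinal = min"

definition sup_ordinal :: "'o ordinal \<Rightarrow> 'o ordinal \<Rightarrow> 'o ordinal"
  where "sup_ordinal = max"

definition Inf_ordinal :: "'o ordinal set \<Rightarrow> 'o ordinal"
  where "Inf_ordinal A = (LEAST \<alpha>. \<alpha> \<in> A)"

definition Sup_ordinal :: "'o ordinal set \<Rightarrow> 'o ordinal"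
  where "Sup_ordinal A = (LEAST \<alpha>. \<forall>\<beta>\<in>A. \<beta> \<le> \<alpha>)"

instance
proof
  fix x z :: "'o ordinal" and A :: "'o ordinal set"
  show "Inf A \<le> x" if "x \<in> A"
    unfolding Inf_ordinal_def using that by (rule Least_le)
  show "z \<le> Inf A" if ne: "A \<noteq> {}" and le: "\<And>x. x \<in> A \<Longrightarrow> z \<le> x"
  proof (rule le)
    from ne obtain a where "a \<in> A" by blast
    then show "Inf A \<in> A" unfolding Inf_ordinal_def by (rule LeastI)
  qed
  show "x \<le> Sup A" if "x \<in> A" "bdd_above A"
  proof -
    from that(2) obtain b where "\<forall>\<beta>\<in>A. \<beta> \<le> b" unfolding bdd_above_def by blast
    then have "\<forall>\<beta>\<in>A. \<beta> \<le> Sup A" unfolding Sup_ordinal_def by (rule LeastI)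
    with that(1) show ?thesis by blast
  qed
  show "Sup A \<le> z" if "\<And>x. x \<in> A \<Longrightarrow> x \<le> z"
    unfolding Sup_ordinal_def using that by (intro Least_le) blast
qed (auto simp: inf_ordinal_def sup_ordinal_def)

end

lemma ordinal_zero_le: "0 \<le> (\<alpha> :: 'o ordinal)"
proof transfer
  fix r :: "('o + nat) rel" assume "(r, r) \<in> ordIso"
  then have "Well_order r" by (simp add: ordIso_self_iff)
  then show "({}, r) \<in> ordLeq"
    by (auto simp: ordLeq_def embed_def Field_def)
qed

lemma ordinal_Sup_empty: "Sup {} = (0 :: 'o ordinal)"
  by (auto simp: Sup_ordinal_def intro!: Least_equality ordinal_zero_le)

definition osuc :: "'o ordinal \<Rightarrow> 'o ordinal"
  where "osuc \<alpha> = (LEAST \<beta>. \<alpha> < \<beta>)"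

lemma ordinal_no_top: "\<exists>\<beta>. (\<alpha> :: 'o ordinal) < \<beta>"
proof transfer
  fix r :: "('o + nat) rel" assume "(r, r) \<in> ordIso"
  then have r: "Well_order r" by (simp add: ordIso_self_iff)
  have "infinite (UNIV :: ('o + nat) set)" by simp
  then obtain f :: "'o + nat \<Rightarrow> 'o + nat" where f: "bij_betw f UNIV (UNIV - {Inr 0})"
    using infinite_imp_bij_betw[of UNIV "Inr 0"] by blast
  define p :: "'o + nat" where "p = Inr 0"
  define r' where "r' = dir_image r f"
  have inj: "inj_on f (Field r)" using f by (meson bij_betw_def inj_on_subset subset_UNIV)
  have rr': "(r, r') \<in> ordIso" unfolding r'_def by (rule dir_image_ordIso[OF r inj])
  have r': "Well_order r'" using rr' unfolding ordIso_def by auto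
  have p: "p \<notin> Field r'"
    using f dir_image_Field[of r f] unfolding r'_def p_def bij_betw_def by auto
  define s where "s = r' \<union> insert p (Field r') \<times> {p}"
  have Fs: "Field s = insert p (Field r')" unfolding s_def Field_def by auto
  have lin: "Linear_order r'" and wf: "wf (r' - Id)" using r' by (auto simp: well_order_on_def)
  have Fr: "x \<in> Field r'" "y \<in> Field r'" if "(x, y) \<in> r'" for x y
    using that by (auto simp: Field_def)
  have tr: "(x, z) \<in> r'" if "(x, y) \<in> r'" "(y, z) \<in> r'" for x y z
    using lin that unfolding order_on_defs by (meson transD)
  have an: "x = y" if "(x, y) \<in> r'" "(y, x) \<in> r'" for x y
    using lin that unfolding order_on_defs by (meson antisymD)
  have re: "(x, x) \<in> r'" if "x \<in> Field r'" for x
    using lin that unfolding order_on_defs refl_on_def by blast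
  have tot: "(x, y) \<in> r' \<or> (y, x) \<in> r'" if "x \<in> Field r'" "y \<in> Field r'" for x y
    using lin re that unfolding order_on_defs total_on_def by metis
  have mem: "(x, y) \<in> s \<longleftrightarrow> (x, y) \<in> r' \<or> (x = p \<or> x \<in> Field r') \<and> y = p" for x y
    by (auto simp: s_def)
  have "Linear_order s"
    unfolding order_on_defs
  proof (intro conjI)
    show "Refl s"
      unfolding refl_on_def Fs using mem re by blast
    show "s \<subseteq> Field s \<times> Field s"
      by (auto intro: FieldI1 FieldI2)
    show "trans s"
    proof (rule transI)
      fix x y z assume xy: "(x, y) \<in> s" and yz: "(y, z) \<in> s"
      show "(x, z) \<in> s"
      proof (cases "z = p")
        case True
        with xy p Fr(1)[of x y] show ?thesis unfolding mem by blast
      next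
        case False
        with yz have 1: "(y, z) \<in> r'" unfolding mem by blast
        then have "y \<noteq> p" using Fr(1)[OF 1] p by blast
        with xy have "(x, y) \<in> r'" unfolding mem by blast
        from tr[OF this 1] show ?thesis unfolding mem by blast
      qed
    qed
    show "antisym s"
    proof (rule antisymI)
      fix x y assume xy: "(x, y) \<in> s" and yx: "(y, x) \<in> s"
      show "x = y"
      proof (cases "(x, y) \<in> r'")
        case True
        with p Fr(1)[OF True] yx have "(y, x) \<in> r'" unfolding mem by blast
        with True show ?thesis by (rule an)
      next
        case False
        with xy have "y = p" unfolding mem by blast
        with yx p Fr(1)[of y x] show ?thesis unfolding mem by blast
      qed
    qed
    show "Total s"
      unfolding total_on_def Fs using mem tot by blast
  qed
  moreover have "wf (s - Id)"
  proof -
    have eq: "s - Id = (r' - Id) \<union> Field r' \<times> {p}" using p by (auto simp: s_def)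
    have w: "wf (Field r' \<times> {p})"
    proof (rule wfI_min)
      fix x Q assume "x \<in> (Q :: ('o + nat) set)"
      then show "\<exists>z\<in>Q. \<forall>y. (y, z) \<in> Field r' \<times> {p} \<longrightarrow> y \<notin> Q"
        using p by (cases "Q \<subseteq> {p}") auto
    qed
    show ?thesis unfolding eq
      by (rule wf_Un[OF wf w]) (use p in \<open>auto simp: Field_def\<close>)
  qed
  ultimately have s: "Well_order s" by (simp add: well_order_on_def)
  have "underS s p = Field r'" using p by (auto simp: underS_def s_def intro: FieldI1)
  moreover have "Restr s (Field r') = r'" using p by (auto simp: s_def Field_def)
  ultimately have "(r', s) \<in> ordLess"
    using underS_Restr_ordLess[OF s, of p] Fs by auto
  then have "(r, s) \<in> ordLess" using rr' ordIso_ordLess_trans by blast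
  then show "\<exists>s\<in>{s :: ('o + nat) rel. (s, s) \<in> ordIso}. (r, s) \<in> ordLess"
    using s by (auto simp: ordIso_self_iff)
qed

lemma less_osuc: "\<alpha> < osuc \<alpha>"
  unfolding osuc_def by (rule LeastI_ex[OF ordinal_no_top])

lemma osuc_le: "\<alpha> < \<beta> \<Longrightarrow> osuc \<alpha> \<le> \<beta>"
  unfolding osuc_def by (rule Least_le)

lemma osuc_inject: "osuc \<alpha> = osuc \<beta> \<Longrightarrow> \<alpha> = \<beta>"
  by (metis less_osuc linorder_neqE not_le osuc_le)

lemma zero_neq_osuc: "0 \<noteq> osuc \<alpha>"
  by (metis less_osuc not_le ordinal_zero_le)

definition is_limit :: "'o ordinal \<Rightarrow> bool"
  where "is_limit \<alpha> \<longleftrightarrow> \<alpha> \<noteq> 0 \<and> (\<forall>\<beta>. \<alpha> \<noteq> osuc \<beta>)"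


section \<open>Cantor-Bendixson rank\<close>

definition accumulation_points :: "'x topology \<Rightarrow> 'x set"
  where "accumulation_points X = X derived_set_of topspace X"

text \<open>\<open>CB_derivative X \<alpha>\<close> is the set \<open>X\<^sup>(\<^sup>\<alpha>\<^sup>)\<close>.\<close>

function CB_derivative :: "'x topology \<Rightarrow> 'o ordinal \<Rightarrow> 'x set" where
  "CB_derivative X 0 = topspace X"
| "CB_derivative X (osuc \<alpha>) = accumulation_points (subtopology X (CB_derivative X \<alpha>))"
| "is_limit \<gamma> \<Longrightarrow> CB_derivative X \<gamma> = (\<Inter>\<beta>\<in>{\<beta>. \<beta> < \<gamma>}. CB_derivative X \<beta>)"
proof -
  fix P :: bool and z :: "'x topology \<times> 'o ordinal"
  assume "\<And>X. z = (X, 0) \<Longrightarrow> P" "\<And>X \<alpha>. z = (X, osuc \<alpha>) \<Longrightarrow> P"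
    "\<And>\<gamma> X. is_limit \<gamma> \<Longrightarrow> z = (X, \<gamma>) \<Longrightarrow> P"
  then show P by (cases z) (auto simp: is_limit_def)
qed (auto simp: is_limit_def zero_neq_osuc zero_neq_osuc[symmetric] dest: osuc_inject)
termination
  by (relation "inv_image {(\<alpha>, \<beta> :: 'o ordinal). \<alpha> < \<beta>} snd") (auto simp: less_osuc wf)

text \<open>
  The sets \<open>X\<^sup>(\<^sup>\<alpha>\<^sup>)\<close> decrease strictly until they become constant, so for a space with points in
  \<open>'x\<close> they are constant from some ordinal of cardinality at most \<open>max |'x| \<aleph>\<^sub>0\<close> on. Hence
  restricting to ordinals in \<open>'x ordinal\<close> makes no difference below, and neither does the choice
  of \<open>'o\<close> in \<open>CB_rank\<close> as long as \<open>'o\<close> is at least as large as \<open>'x\<close>.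
\<close>

definition scattered_space :: "'x topology \<Rightarrow> bool"
  where "scattered_space X \<longleftrightarrow> (\<exists>\<alpha> :: 'x ordinal. CB_derivative X \<alpha> = {})"

text \<open>\<open>NoRank\<close> is the symbol that is not an ordinal, used when the supremum does not exist.\<close>

datatype 'o CB_value = Rank (the_rank: "'o ordinal") | NoRank

definition CB_rank :: "'x topology \<Rightarrow> 'x \<Rightarrow> 'o CB_value"
  where "CB_rank X x =
    (if bdd_above {\<alpha> :: 'o ordinal. x \<in> CB_derivative X \<alpha>}
     then Rank (Sup {\<alpha>. x \<in> CB_derivative X \<alpha>}) else NoRank)"


section \<open>The space of normal subgroups\<close>

definition max_n :: "('a, 'b) monoid_scheme \<Rightarrow> bool"
  where "max_n G \<longleftrightarrow> \<not> (\<exists>N :: nat \<Rightarrow> 'a set. (\<forall>i. N i \<lhd> G) \<and> strict_mono N)"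

text \<open>
  A normal subgroup is identified with its indicator function in \<open>{0,1}\<^sup>G\<close>, with \<open>{0,1}\<close>
  rendered as \<open>bool\<close>; the pullback topology along this injection is the subspace topology.
\<close>

definition normal_subgroup_space :: "('a, 'b) monoid_scheme \<Rightarrow> 'a set topology"
  where "normal_subgroup_space G =
    pullback_topology {N. N \<lhd> G} (\<lambda>N. \<lambda>g\<in>carrier G. g \<in> N)
      (product_topology (\<lambda>g. discrete_topology (UNIV :: bool set)) (carrier G))"

definition cb :: "('a, 'b) monoid_scheme \<Rightarrow> 'o CB_value"
  where "cb G = CB_rank (normal_subgroup_space G) {\<one>\<^bsub>G\<^esub>}"

definition residually_finite :: "('a, 'b) monoid_scheme \<Rightarrow> bool"
  where "residually_finite G \<longleftrightarrow>
    (\<forall>g \<in> carrier G - {\<one>\<^bsub>G\<^esub>}. \<exists>N. N \<lhd> G \<and> finite (rcosets\<^bsub>G\<^esub> N) \<and> g \<notin> N)"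

end

theory Submission
  imports Defs "HOL-Algebra.SndIsomorphismGrp"
begin

text \<open>
  In a max-n group \<open>G\<close> every normal subgroup \<open>M\<close> is finitely generated as a normal subgroup, so the
  normal subgroups containing \<open>M\<close> form a neighbourhood of \<open>M\<close>. Hence a maximal element of any
  nonempty set of normal subgroups is isolated in it, and the strictly decreasing sequence of
  derivatives of \<open>X = \<N>(G)\<close> reaches the empty set. The same neighbourhoods identify \<open>\<N>(G/N)\<close> with
  an open subset of \<open>X\<close>, so that \<open>cb(G/N)\<close> is the rank of \<open>N\<close> in \<open>X\<close>.

  When all quotients are residually finite, \<open>X\<^sup>(\<^sup>\<alpha>\<^sup>)\<close> is closed under passing to smaller normal
  subgroups, and \<open>M \<in> X\<^sup>(\<^sup>\<alpha>\<^sup>+\<^sup>1\<^sup>)\<close> iff some \<open>N \<in> X\<^sup>(\<^sup>\<alpha>\<^sup>)\<close> contains \<open>M\<close> with \<open>N/M\<close> infinite. Indeed, if \<open>H\<close>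
  runs through the normal subgroups of finite index containing \<open>M\<close>, the subgroups \<open>N \<inter> H\<close> are
  distinct from \<open>M\<close> and accumulate at it. For \<open>M = {1}\<close> this is the rank formula.
\<close>

section \<open>Ordinals and derivatives\<close>

lemma ordinal_cases:
  obtains (zero) "\<alpha> = 0" | (suc) \<beta> where "\<alpha> = osuc \<beta>" | (limit) "is_limit \<alpha>"
  unfolding is_limit_def by blast

lemma less_osuc_iff: "\<alpha> < osuc \<beta> \<longleftrightarrow> \<alpha> \<le> \<beta>"
  by (meson le_less_trans less_osuc not_le osuc_le)

lemma strict_mono_wellorder_increasing:
  fixes g :: "'w::wellorder \<Rightarrow> 'w"
  assumes "strict_mono g"
  shows "x \<le> g x"
proof (rule ccontr)
  assume "\<not> x \<le> g x"
  then have ex: "g x < x" by simp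
  define m where "m = (LEAST y. g y < y)"
  have m: "g m < m" unfolding m_def using ex by (rule LeastI)
  have "g (g m) < g m" using assms m by (rule strict_monoD)
  then have "m \<le> g m" unfolding m_def by (rule Least_le)
  with m show False by simp
qed

text \<open>Burali-Forti: an injection would carry the order of the whole type to a well-order
  \<open>r\<close> on \<open>'o + nat\<close>, which then has its own order type in
  \<open>'o ordinal\<close>. Sending \<alpha> to the order type of the initial segment below it is
  strictly monotone, yet all its values lie below the order type of \<open>r\<close>.\<close>

lemma no_inj_ordinal: "\<not> inj (f :: 'o ordinal \<Rightarrow> 'o + nat)"
proof
  assume inj: "inj f"
  define R where "R = {(\<alpha>, \<beta> :: 'o ordinal). \<alpha> \<le> \<beta>}"
  have FR: "Field R = UNIV" by (auto simp: R_def Field_def)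
  have "R - Id = {(\<alpha>, \<beta>). \<alpha> < \<beta>}" by (auto simp: R_def)
  then have R: "Well_order R"
    using FR by (auto simp: well_order_on_def linear_order_on_def partial_order_on_def
      preorder_on_def refl_on_def trans_def antisym_def total_on_def wf R_def)
  define r where "r = dir_image R f"
  have r: "Well_order r" unfolding r_def
    by (rule Well_order_dir_image[OF R]) (use inj in \<open>auto intro: inj_on_subset\<close>)
  then have wo: "wo_rel r" by (simp add: wo_rel_def)
  have Fr: "Field r = range f" unfolding r_def by (simp add: dir_image_Field FR)
  have u: "underS r (f \<alpha>) = f ` {..<\<alpha>}" for \<alpha>
    using inj by (auto simp: underS_def r_def dir_image_def R_def inj_eq less_le)
  define a where "a \<alpha> = Restr r (underS r (f \<alpha>))" for \<alpha>
  have aW: "Well_order (a \<alpha>)" for \<alpha> unfolding a_def by (rule Well_order_Restr[OF r])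
  have a_mono: "(a \<alpha>, a \<beta>) \<in> ordLess" if "\<alpha> < \<beta>" for \<alpha> \<beta>
  proof -
    have "underS r (f \<alpha>) < underS r (f \<beta>)"
      unfolding u using that inj by (auto simp: inj_image_subset_iff inj_image_eq_iff psubset_eq)
    then show ?thesis unfolding a_def
      using ofilter_subset_ordLess[OF r] wo_rel.underS_ofilter[OF wo] by blast
  qed
  have a_r: "(a \<alpha>, r) \<in> ordLess" for \<alpha>
    unfolding a_def by (rule underS_Restr_ordLess[OF r]) (simp add: Fr)
  define g where "g \<alpha> = abs_ordinal (a \<alpha>)" for \<alpha>
  have "strict_mono g"
    unfolding g_def by (rule strict_monoI) (simp add: less_ordinal.abs_eq ordIso_self_iff aW a_mono)
  then have "abs_ordinal r \<le> g (abs_ordinal r)"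
    by (rule strict_mono_wellorder_increasing)
  moreover have "g (abs_ordinal r) < abs_ordinal r"
    unfolding g_def by (simp add: less_ordinal.abs_eq ordIso_self_iff aW r a_r)
  ultimately show False by simp
qed

section \<open>Cantor-Bendixson derivatives of a general space\<close>

lemma CB_derivative_subset_topspace: "CB_derivative X \<alpha> \<subseteq> topspace X"
proof (induction \<alpha> rule: less_induct)
  case (less \<alpha>)
  show ?case
  proof (cases \<alpha> rule: ordinal_cases)
    case (suc \<beta>)
    with less.IH[of \<beta>] show ?thesis
      by (auto simp: accumulation_points_def derived_set_of_subtopology less_osuc)
  next
    case limit
    \<comment> \<open>Positivity puts \<open>0\<close> among the indices; an empty intersection
      would be the whole type.\<close>
    then have "0 < \<alpha>" using ordinal_zero_le[of \<alpha>] by (simp add: is_limit_def less_le)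
    with less limit show ?thesis by auto
  qed simp
qed

text \<open>The derived set in a subspace is the trace of the derived set in \<open>X\<close>, so
  successor stages can be handled with the open sets of \<open>X\<close> alone.\<close>

lemma CB_derivative_osuc_iff:
  "x \<in> CB_derivative X (osuc \<alpha>) \<longleftrightarrow>
    x \<in> CB_derivative X \<alpha> \<and> x \<in> X derived_set_of CB_derivative X \<alpha>"
  using CB_derivative_subset_topspace[of X \<alpha>]
  by (simp add: accumulation_points_def derived_set_of_subtopology inf.absorb2)

lemma CB_derivative_antimono:
  assumes "\<alpha> \<le> \<beta>"
  shows "CB_derivative X \<beta> \<subseteq> CB_derivative X \<alpha>"
  using assms
proof (induction \<beta> rule: less_induct)
  case (less \<beta>)
  show ?case
  proof (cases \<beta> rule: ordinal_cases)
    case zero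
    with less.prems show ?thesis using ordinal_zero_le[of \<alpha>] by simp
  next
    case (suc \<gamma>)
    show ?thesis
    proof (cases "\<alpha> = \<beta>")
      case False
      then have "\<alpha> \<le> \<gamma>" using less.prems suc by (metis le_neq_trans less_osuc_iff)
      then have "CB_derivative X \<gamma> \<subseteq> CB_derivative X \<alpha>"
        using less.IH[of \<gamma>] suc by (simp add: less_osuc)
      then show ?thesis unfolding suc using CB_derivative_osuc_iff[of _ X \<gamma>] by blast
    qed simp
  next
    case limit
    with less show ?thesis by (cases "\<alpha> = \<beta>") auto
  qed
qed


text \<open>If no stage were empty, each would lose a point at the next step. Points lost at
  different stages are distinct, so \<open>'o ordinal\<close> would embed into \<open>'x\<close>
  and, through \<open>i\<close>, into \<open>'o + nat\<close>. Keeping \<open>'o\<close> separate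
  from \<open>'x\<close> allows ordinals over a type larger than that of the points.\<close>

lemma CB_derivative_eventually_empty:
  fixes X :: "'x topology" and i :: "'x \<Rightarrow> 'o + nat"
  assumes i: "inj i"
    and isolated: "\<And>P. P \<noteq> {} \<Longrightarrow> P \<subseteq> topspace X \<Longrightarrow> \<not> P \<subseteq> X derived_set_of P"
  shows "\<exists>\<alpha> :: 'o ordinal. CB_derivative X \<alpha> = {}"
proof (rule ccontr)
  assume "\<not> ?thesis"
  then have "\<exists>x. x \<in> CB_derivative X \<alpha> \<and> x \<notin> CB_derivative X (osuc \<alpha>)" for \<alpha> :: "'o ordinal"
    using isolated[of "CB_derivative X \<alpha>"] CB_derivative_subset_topspace[of X \<alpha>]
    unfolding CB_derivative_osuc_iff by blast
  then obtain p where p: "\<And>\<alpha> :: 'o ordinal. p \<alpha> \<in> CB_derivative X \<alpha>"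
      "\<And>\<alpha>. p \<alpha> \<notin> CB_derivative X (osuc \<alpha>)"
    by metis
  have "p \<alpha> \<noteq> p \<beta>" if "\<alpha> < \<beta>" for \<alpha> \<beta>
    using p CB_derivative_antimono[OF osuc_le[OF that], of X] by (metis subsetD)
  then have "inj p" by (metis injI linorder_neqE)
  then have "inj (i \<circ> p)" using i by (simp add: inj_compose)
  then show False using no_inj_ordinal by blast
qed

text \<open>The first stage omitting \<open>x\<close> is neither \<open>0\<close> nor a limit, where
  stages are intersections of earlier ones. So it is a successor \<open>osuc \<beta>\<close>, and
  the supremum defining the rank is the maximum \<beta>.\<close>

lemma CB_rank_attained:
  fixes X :: "'x topology" and \<gamma> :: "'o ordinal"
  assumes "x \<in> topspace X" and \<gamma>: "x \<notin> CB_derivative X \<gamma>"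
  obtains \<beta> :: "'o ordinal"
  where "CB_rank X x = Rank \<beta>" "\<And>\<alpha>. x \<in> CB_derivative X \<alpha> \<longleftrightarrow> \<alpha> \<le> \<beta>"
proof -
  define \<mu> where "\<mu> = (LEAST \<gamma> :: 'o ordinal. x \<notin> CB_derivative X \<gamma>)"
  have \<mu>: "x \<notin> CB_derivative X \<mu>" unfolding \<mu>_def using \<gamma> by (rule LeastI)
  have below: "x \<in> CB_derivative X \<alpha>" if "\<alpha> < \<mu>" for \<alpha>
    using that not_less_Least unfolding \<mu>_def by blast
  obtain \<beta> where \<beta>: "\<mu> = osuc \<beta>"
    by (cases \<mu> rule: ordinal_cases) (use \<mu> below assms(1) in auto)
  have iff: "x \<in> CB_derivative X \<alpha> \<longleftrightarrow> \<alpha> \<le> \<beta>" for \<alpha>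
    using \<mu> below CB_derivative_antimono[of \<mu> \<alpha> X] unfolding \<beta>
    by (metis less_osuc_iff not_le subsetD)
  then have "{\<alpha>. x \<in> CB_derivative X \<alpha>} = {..\<beta>}" by auto
  then have "CB_rank X x = Rank \<beta>" unfolding CB_rank_def by simp
  with iff show thesis by (rule that[rotated])
qed

section \<open>The topology under max-n\<close>

lemma topspace_normal_subgroup_space [simp]:
  "topspace (normal_subgroup_space G) = {N. N \<lhd> G}"
  by (auto simp: normal_subgroup_space_def topspace_pullback_topology)

text \<open>These are the cylinder sets: the box \<open>?U\<close> constrains only the finitely many
  coordinates in \<open>F\<close>.\<close>

lemma openin_normal_subgroup_space_basic:
  assumes "finite F" "F \<subseteq> carrier G"
  shows "openin (normal_subgroup_space G) {N. N \<lhd> G \<and> N \<inter> F = M \<inter> F}"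
  unfolding normal_subgroup_space_def openin_pullback_topology
proof (intro exI conjI)
  let ?U = "\<lambda>g. if g \<in> F then {g \<in> M} else (UNIV :: bool set)"
  show "openin (product_topology (\<lambda>g. discrete_topology UNIV) (carrier G)) (Pi\<^sub>E (carrier G) ?U)"
    by (rule openin_PiE_gen[THEN iffD2])
      (use assms in \<open>auto intro: finite_subset[OF _ \<open>finite F\<close>]\<close>)
  show "{N. N \<lhd> G \<and> N \<inter> F = M \<inter> F} =
      (\<lambda>N. \<lambda>g\<in>carrier G. g \<in> N) -` Pi\<^sub>E (carrier G) ?U \<inter> {N. N \<lhd> G}"
    using assms(2) by (auto simp: PiE_iff split: if_splits)
qed

text \<open>An open set contains a box around \<open>M\<close> with finitely many constrained
  coordinates; these form \<open>F\<close>. So cylinder sets are a neighbourhood base.\<close>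

lemma openin_normal_subgroup_space_imp_basic:
  assumes "openin (normal_subgroup_space G) S" "M \<in> S"
  obtains F where "finite F" "F \<subseteq> carrier G"
    "\<And>N. N \<lhd> G \<Longrightarrow> N \<inter> F = M \<inter> F \<Longrightarrow> N \<in> S"
proof -
  let ?c = "\<lambda>N. \<lambda>g\<in>carrier G. g \<in> N"
  obtain U where U: "openin (product_topology (\<lambda>g. discrete_topology (UNIV :: bool set)) (carrier G)) U"
    "S = ?c -` U \<inter> {N. N \<lhd> G}"
    using assms(1) by (auto simp: normal_subgroup_space_def openin_pullback_topology)
  have "?c M \<in> U" using U(2) assms(2) by blast
  then obtain V where V: "finite {g \<in> carrier G. V g \<noteq> UNIV}" "?c M \<in> Pi\<^sub>E (carrier G) V"
    "Pi\<^sub>E (carrier G) V \<subseteq> U"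
    using U(1) unfolding openin_product_topology_alt by fastforce
  show thesis
  proof (rule that[OF V(1)])
    fix N assume N: "N \<lhd> G" "N \<inter> {g \<in> carrier G. V g \<noteq> UNIV} = M \<inter> {g \<in> carrier G. V g \<noteq> UNIV}"
    have "(g \<in> N) \<in> V g" if "g \<in> carrier G" for g
    proof (cases "V g = UNIV")
      case False
      with N(2) that have "g \<in> N \<longleftrightarrow> g \<in> M" by blast
      moreover have "(g \<in> M) \<in> V g" using V(2) that by (auto simp: PiE_iff)
      ultimately show ?thesis by simp
    qed simp
    then have "?c N \<in> Pi\<^sub>E (carrier G) V" by (simp add: PiE_iff)
    with V(3) N(1) show "N \<in> S" unfolding U(2) by blast
  qed auto
qed

section \<open>Consequences of the maximal condition\<close>

lemma max_n_maximal:
  assumes "max_n G" "P \<noteq> {}" "\<And>N. N \<in> P \<Longrightarrow> N \<lhd> G"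
  obtains N where "N \<in> P" "\<And>N'. N' \<in> P \<Longrightarrow> N \<subseteq> N' \<Longrightarrow> N' = N"
proof (rule ccontr)
  assume "\<not> thesis"
  with that have step: "\<And>N. N \<in> P \<Longrightarrow> \<exists>N'. N' \<in> P \<and> N \<subset> N'" by (metis psubsetI)
  have "\<exists>f. \<forall>n::nat. f n \<in> P \<and> f n \<subset> f (Suc n)"
    by (rule dependent_nat_choice) (use assms(2) step in auto)
  then obtain f :: "nat \<Rightarrow> _" where f: "\<forall>n. f n \<in> P \<and> f n \<subset> f (Suc n)" ..
  then have "strict_mono f" by (simp add: strict_mono_Suc_iff)
  moreover have "\<forall>n. f n \<lhd> G" using f assms(3) by simp
  ultimately show False using assms(1) unfolding max_n_def by metis
qed

context group
begin

lemma normal_Inter: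
  assumes "\<A> \<noteq> {}" "\<And>N. N \<in> \<A> \<Longrightarrow> N \<lhd> G"
  shows "\<Inter>\<A> \<lhd> G"
  using assms by (intro normal_invI subgroups_Inter) (auto simp: normal_inv_iff)

text \<open>\<open>C F\<close> is the normal closure of \<open>F\<close>. Among the closures of
  finite subsets of \<open>N\<close> a maximal one exists, and adding one more element of
  \<open>N\<close> to its generators cannot enlarge it.\<close>

lemma max_n_finitely_generated:
  assumes "max_n G" "N \<lhd> G"
  obtains F where "finite F" "F \<subseteq> N" "\<And>M. M \<lhd> G \<Longrightarrow> F \<subseteq> M \<Longrightarrow> N \<subseteq> M"
proof -
  define C where "C F = \<Inter>{M. M \<lhd> G \<and> F \<subseteq> M}" for F
  have CN: "C F \<subseteq> N" if "F \<subseteq> N" for F using that assms(2) by (auto simp: C_def)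
  have normal: "C F \<lhd> G" if "F \<subseteq> N" for F
    unfolding C_def by (rule normal_Inter) (use that assms(2) in auto)
  have mono: "F \<subseteq> F' \<Longrightarrow> C F \<subseteq> C F'" and ext: "F \<subseteq> C F" for F F'
    by (auto simp: C_def)
  obtain K where K: "K \<in> C ` {F. finite F \<and> F \<subseteq> N}"
    "\<And>K'. K' \<in> C ` {F. finite F \<and> F \<subseteq> N} \<Longrightarrow> K \<subseteq> K' \<Longrightarrow> K' = K"
    by (rule max_n_maximal[OF assms(1), of "C ` {F. finite F \<and> F \<subseteq> N}"]) (use normal in auto)
  from K(1) obtain F where F: "finite F" "F \<subseteq> N" "K = C F" by blast
  have "x \<in> C F" if "x \<in> N" for x
  proof -
    have "C (insert x F) = C F"
      using K(2)[of "C (insert x F)"] F that mono[of F "insert x F"] by blast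
    then show ?thesis using ext[of "insert x F"] by blast
  qed
  then have "N \<subseteq> M" if "M \<lhd> G" "F \<subseteq> M" for M
    using that by (auto simp: C_def)
  with F that show thesis by blast
qed

text \<open>A finite set \<open>E\<close> of normal generators of \<open>M\<close> forces every
  subgroup close to \<open>M\<close> to contain \<open>M\<close>. What remains of closeness is to
  avoid finitely many elements outside \<open>M\<close>.\<close>

lemma max_n_derived_set_iff:
  assumes "max_n G" "M \<lhd> G" and P: "\<And>N. N \<in> P \<Longrightarrow> N \<lhd> G"
  shows "M \<in> normal_subgroup_space G derived_set_of P \<longleftrightarrow>
    (\<forall>F. finite F \<and> F \<subseteq> carrier G - M \<longrightarrow> (\<exists>N\<in>P. M \<subset> N \<and> N \<inter> F = {}))" (is "?L \<longleftrightarrow> ?R")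
proof
  assume L: ?L
  show ?R
  proof (intro allI impI)
    fix F assume F: "finite F \<and> F \<subseteq> carrier G - M"
    obtain E where E: "finite E" "E \<subseteq> M" "\<And>N. N \<lhd> G \<Longrightarrow> E \<subseteq> N \<Longrightarrow> M \<subseteq> N"
      using max_n_finitely_generated[OF assms(1,2)] by blast
    have "E \<union> F \<subseteq> carrier G"
      using E(2) F subgroup.subset[OF normal_imp_subgroup[OF assms(2)]] by blast
    define S where "S = {N. N \<lhd> G \<and> N \<inter> (E \<union> F) = M \<inter> (E \<union> F)}"
    have "M \<in> S \<and> openin (normal_subgroup_space G) S"
      unfolding S_def using E(1) F \<open>E \<union> F \<subseteq> carrier G\<close> assms(2)
      by (simp add: openin_normal_subgroup_space_basic)
    then have "\<exists>N. N \<noteq> M \<and> N \<in> P \<and> N \<in> S"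
      using L unfolding in_derived_set_of by simp
    then obtain N where N: "N \<noteq> M" "N \<in> P" "N \<lhd> G" "N \<inter> (E \<union> F) = M \<inter> (E \<union> F)"
      unfolding S_def by blast
    have "E \<subseteq> N" using N(4) E(2) by blast
    then have "M \<subseteq> N" by (rule E(3)[OF N(3)])
    moreover have "N \<inter> F = {}" using N(4) F by blast
    ultimately show "\<exists>N\<in>P. M \<subset> N \<and> N \<inter> F = {}" using N(1,2) by blast
  qed
next
  assume R: ?R
  show ?L unfolding in_derived_set_of
  proof (intro conjI allI impI)
    show "M \<in> topspace (normal_subgroup_space G)" using assms(2) by simp
    fix S assume S: "M \<in> S \<and> openin (normal_subgroup_space G) S"
    then obtain F where F: "finite F" "F \<subseteq> carrier G"
      "\<And>N. N \<lhd> G \<Longrightarrow> N \<inter> F = M \<inter> F \<Longrightarrow> N \<in> S"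
      using openin_normal_subgroup_space_imp_basic by metis
    \<comment> \<open>On \<open>F \<inter> M\<close> agreement with \<open>M\<close> is automatic
      for subgroups above \<open>M\<close>, so only \<open>F - M\<close> has to be avoided.\<close>
    obtain N where N: "N \<in> P" "M \<subset> N" "N \<inter> (F - M) = {}"
      using R[rule_format, of "F - M"] F by blast
    have "N \<in> S" by (rule F(3)[OF P[OF N(1)]]) (use N in blast)
    then show "\<exists>y. y \<noteq> M \<and> y \<in> P \<and> y \<in> S" using N by blast
  qed
qed

text \<open>For a maximal element of \<open>P\<close>, the criterion with empty \<open>F\<close>
  would demand a strictly larger member of \<open>P\<close>.\<close>

lemma max_n_isolated:
  assumes "max_n G" "P \<noteq> {}" "P \<subseteq> topspace (normal_subgroup_space G)"
  shows "\<not> P \<subseteq> normal_subgroup_space G derived_set_of P"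
proof -
  have P: "N \<lhd> G" if "N \<in> P" for N using assms(3) that by auto
  obtain N where "N \<in> P" "\<And>N'. N' \<in> P \<Longrightarrow> N \<subseteq> N' \<Longrightarrow> N' = N"
    using max_n_maximal[OF assms(1,2) P] by blast
  then have "N \<notin> normal_subgroup_space G derived_set_of P"
    using max_n_derived_set_iff[OF assms(1) P[OF \<open>N \<in> P\<close>] P] by (metis Diff_empty
      empty_subsetI finite.emptyI order.strict_implies_order psubset_eq)
  with \<open>N \<in> P\<close> show ?thesis by blast
qed

end

section \<open>Finite quotients\<close>

text \<open>Counting the cosets of \<open>M\<close> that meet \<open>N\<close> makes sense without
  \<open>M \<subseteq> N\<close>. For subgroups it says that \<open>M \<inter> N\<close> has finite
  index in \<open>N\<close>; with \<open>carrier G\<close> for \<open>N\<close> it is finiteness of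
  the index of \<open>M\<close>.\<close>

definition finite_quotient :: "('a, 'b) monoid_scheme \<Rightarrow> 'a set \<Rightarrow> 'a set \<Rightarrow> bool"
  where "finite_quotient G M N \<longleftrightarrow> finite ((\<lambda>x. M #>\<^bsub>G\<^esub> x) ` N)"

lemma finite_image_transfer:
  assumes "finite (f ` A)" "B \<subseteq> A" "\<And>x y. x \<in> B \<Longrightarrow> y \<in> B \<Longrightarrow> f x = f y \<Longrightarrow> g x = g y"
  shows "finite (g ` B)"
proof -
  have "g x = g (inv_into B f (f x))" if "x \<in> B" for x
    using assms(3)[OF that inv_into_into[of "f x" f B]] that by (simp add: f_inv_into_f)
  then have "g ` B = (\<lambda>y. g (inv_into B f y)) ` f ` B"
    by (force simp: image_image)
  moreover have "finite (f ` B)" using assms(1,2) by (meson finite_subset image_mono)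
  ultimately show ?thesis by simp
qed

context group
begin

lemma normal_subset: "N \<lhd> G \<Longrightarrow> N \<subseteq> carrier G"
  by (simp add: normal_imp_subgroup subgroup.subset)

lemma rcos_eq_iff:
  assumes "subgroup M G" "x \<in> carrier G" "y \<in> carrier G"
  shows "M #> x = M #> y \<longleftrightarrow> x \<otimes> inv y \<in> M"
  using assms by (metis is_group rcos_self repr_independence subgroup.rcos_module)

text \<open>If \<open>x\<close> and \<open>y\<close> in \<open>N'\<close> lie in one coset of
  \<open>M\<close>, then \<open>x \<otimes> inv y\<close> is in \<open>M \<inter> N'\<close>, hence
  in \<open>M'\<close>. This covers both enlarging \<open>M\<close> and intersecting a subgroup of
  finite index with \<open>N'\<close>.\<close>

lemma finite_quotient_transfer:
  assumes "finite_quotient G M N" "subgroup M G" "subgroup M' G" "subgroup N' G" "N \<subseteq> carrier G"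
    and "N' \<subseteq> N" "M \<inter> N' \<subseteq> M'"
  shows "finite_quotient G M' N'"
  unfolding finite_quotient_def
proof (rule finite_image_transfer[OF assms(1)[unfolded finite_quotient_def] assms(6)])
  fix x y assume xy: "x \<in> N'" "y \<in> N'" "M #> x = M #> y"
  have c: "x \<in> carrier G" "y \<in> carrier G" using xy assms(4) by (auto dest: subgroup.subset)
  have "x \<otimes> inv y \<in> M" using xy(3) rcos_eq_iff[OF assms(2) c] by simp
  moreover have "x \<otimes> inv y \<in> N'"
    using xy assms(4) by (simp add: subgroup.m_closed subgroup.m_inv_closed)
  ultimately show "M' #> x = M' #> y" using assms(7) rcos_eq_iff[OF assms(3) c] by blast
qed

text \<open>A coset of the intersection is determined by the pair of cosets of \<open>H\<close> and
  \<open>H'\<close>.\<close>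

lemma finite_quotient_Int:
  assumes "finite_quotient G H K" "finite_quotient G H' K"
    and "subgroup H G" "subgroup H' G" "K \<subseteq> carrier G"
  shows "finite_quotient G (H \<inter> H') K"
  unfolding finite_quotient_def
proof (rule finite_image_transfer[where f = "\<lambda>x. (H #> x, H' #> x)" and A = K])
  have "finite ((\<lambda>x. H #> x) ` K \<times> (\<lambda>x. H' #> x) ` K)"
    using assms(1,2) by (simp add: finite_quotient_def)
  then show "finite ((\<lambda>x. (H #> x, H' #> x)) ` K)" by (rule finite_subset[rotated]) auto
  fix x y assume "x \<in> K" "y \<in> K" "(H #> x, H' #> x) = (H #> y, H' #> y)"
  then show "(H \<inter> H') #> x = (H \<inter> H') #> y"
    using assms(3-5) by (simp add: rcos_eq_iff subgroups_Inter_pair subset_iff)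
qed simp

lemma subset_set_mult:
  assumes "subgroup H G" "subgroup K G"
  shows "H \<subseteq> H <#> K" "K \<subseteq> H <#> K"
proof -
  have "x \<otimes> \<one> \<in> H <#> K" if "x \<in> H" for x
    unfolding set_mult_def using that subgroup.one_closed[OF assms(2)] by blast
  then show "H \<subseteq> H <#> K" using subgroup.mem_carrier[OF assms(1)] by auto
  have "\<one> \<otimes> x \<in> H <#> K" if "x \<in> K" for x
    unfolding set_mult_def using that subgroup.one_closed[OF assms(1)] by blast
  then show "K \<subseteq> H <#> K" using subgroup.mem_carrier[OF assms(2)] by auto
qed

text \<open>As \<open>M\<close> is normal, the coset of a product is the product of the cosets,
  which leaves finitely many possibilities.\<close>

lemma finite_quotient_set_mult:
  assumes "finite_quotient G M H" "finite_quotient G M K" "M \<lhd> G"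
    and "H \<subseteq> carrier G" "K \<subseteq> carrier G"
  shows "finite_quotient G M (H <#> K)"
proof -
  let ?q = "\<lambda>x. M #> x"
  have "?q ` (H <#> K) \<subseteq> (\<lambda>(U, V). U <#> V) ` (?q ` H \<times> ?q ` K)"
  proof
    fix U assume "U \<in> ?q ` (H <#> K)"
    then obtain h k where "h \<in> H" "k \<in> K" "U = M #> (h \<otimes> k)"
      by (auto simp: set_mult_def)
    moreover from this have "(M #> h) <#> (M #> k) = M #> (h \<otimes> k)"
      using assms by (intro normal.rcos_sum) auto
    ultimately show "U \<in> (\<lambda>(U, V). U <#> V) ` (?q ` H \<times> ?q ` K)" by force
  qed
  then show ?thesis using assms(1,2) unfolding finite_quotient_def
    by (meson finite_SigmaI finite_imageI finite_subset)
qed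

lemma finite_quotient_self: "subgroup M G \<Longrightarrow> finite_quotient G M M"
proof -
  assume "subgroup M G"
  then have "(\<lambda>x. M #> x) ` M \<subseteq> {M}" 
    by (intro image_subsetI) (simp add: coset_join2 subgroup.mem_carrier)
  then show ?thesis unfolding finite_quotient_def by (rule finite_subset) simp
qed

text \<open>\<open>R\<close> represents the nontrivial cosets of \<open>M\<close> in
  \<open>W\<close>. A subgroup above \<open>M\<close> containing a point of \<open>W - M\<close>
  contains its whole coset, hence an element of \<open>R\<close>.\<close>

lemma finite_quotient_transversal:
  assumes "finite_quotient G M W" "M \<lhd> G" "W \<subseteq> carrier G"
  obtains R where "finite R" "R \<subseteq> carrier G - M"
    "\<And>N. N \<lhd> G \<Longrightarrow> M \<subseteq> N \<Longrightarrow> N \<inter> R = {} \<Longrightarrow> N \<inter> W \<subseteq> M"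
proof -
  have "finite ((\<lambda>x. M #> x) ` (W - M))"
    using assms(1) unfolding finite_quotient_def by (rule finite_subset[rotated]) auto
  then obtain R where R: "R \<subseteq> W - M" "finite R" "(\<lambda>x. M #> x) ` (W - M) = (\<lambda>x. M #> x) ` R"
    by (metis finite_subset_image order_refl)
  have RM: "R \<subseteq> carrier G - M" using R(1) assms(3) by blast
  have avoid: "N \<inter> W \<subseteq> M" if N: "N \<lhd> G" "M \<subseteq> N" "N \<inter> R = {}" for N
  proof (rule ccontr)
    assume "\<not> N \<inter> W \<subseteq> M"
    then obtain x where x: "x \<in> N" "x \<in> W" "x \<notin> M" by blast
    then obtain r where r: "r \<in> R" "M #> r = M #> x" using R(3) by (metis DiffI image_iff)
    have c: "r \<in> carrier G" "x \<in> carrier G" using r x R(1) assms(3) by auto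
    have "r \<otimes> inv x \<in> N"
      using rcos_eq_iff[OF normal_imp_subgroup[OF assms(2)] c] r(2) N(2) by blast
    then have "r \<otimes> inv x \<otimes> x \<in> N"
      using x(1) normal_imp_subgroup[OF N(1)] by (simp add: subgroup.m_closed)
    then have "r \<in> N" using c by (simp add: m_assoc)
    with r N(3) show False by blast
  qed
  show thesis by (rule that[OF R(2) RM avoid])
qed

text \<open>A single element is avoided by pulling back a finite-index subgroup of the quotient;
  finitely many are handled by intersecting, starting from \<open>carrier G\<close>.\<close>

lemma residually_finite_FactGroup_avoid:
  assumes M: "M \<lhd> G" and rf: "residually_finite (G Mod M)"
    and "finite F" "F \<subseteq> carrier G - M"
  obtains H where "H \<lhd> G" "M \<subseteq> H" "finite_quotient G H (carrier G)" "H \<inter> F = {}"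
proof -
  interpret M: normal M G by (rule M)
  have one: "\<exists>H. H \<lhd> G \<and> M \<subseteq> H \<and> finite_quotient G H (carrier G) \<and> g \<notin> H"
    if g: "g \<in> carrier G" "g \<notin> M" for g
  proof -
    interpret Q: group "G Mod M" by (rule M.factorgroup_is_group)
    have "M #> g \<in> carrier (G Mod M)" using g by (simp add: carrier_FactGroup)
    moreover have "M #> g \<noteq> M" using g M.subgroup_axioms by (metis rcos_self)
    ultimately obtain K where K: "K \<lhd> G Mod M" "finite (rcosets\<^bsub>G Mod M\<^esub> K)" "M #> g \<notin> K"
      using rf by (auto simp: residually_finite_def)
    have Ks: "subgroup K (G Mod M)" using K(1) by (rule normal_imp_subgroup)
    \<comment> \<open>Elements of \<open>K\<close> are cosets of \<open>M\<close>, so their union is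
      the preimage of \<open>K\<close> under the quotient map.\<close>
    define H where "H = \<Union>K"
    have H: "H = {x \<in> carrier G. M #> x \<in> K}"
      unfolding H_def by (rule M.factgroup_subgroup_union_char[OF Ks])
    have nH: "H \<lhd> G" unfolding H_def by (rule M.factgroup_subgroup_union_normal[OF K(1)])
    have "M \<in> K" using subgroup.one_closed[OF Ks] by simp
    then have "M \<subseteq> H" unfolding H_def by blast
    moreover have "finite_quotient G H (carrier G)"
      unfolding finite_quotient_def
    proof (rule finite_image_transfer)
      show "finite ((\<lambda>x. K #>\<^bsub>G Mod M\<^esub> (M #> x)) ` carrier G)"
        using K(2) by (rule finite_subset[rotated]) (auto simp: RCOSETS_def carrier_FactGroup)
      fix x y assume xy: "x \<in> carrier G" "y \<in> carrier G"
        "K #>\<^bsub>G Mod M\<^esub> (M #> x) = K #>\<^bsub>G Mod M\<^esub> (M #> y)"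
      have c: "M #> x \<in> carrier (G Mod M)" "M #> y \<in> carrier (G Mod M)"
        using xy by (auto simp: carrier_FactGroup)
      have "(M #> x) \<otimes>\<^bsub>G Mod M\<^esub> inv\<^bsub>G Mod M\<^esub> (M #> y) \<in> K"
        using Q.rcos_eq_iff[OF Ks c] xy(3) by blast
      then have "M #> (x \<otimes> inv y) \<in> K"
        using xy(1,2) c by (simp add: M.inv_FactGroup M.rcos_inv M.rcos_sum)
      then have "x \<otimes> inv y \<in> H" using xy by (simp add: H)
      then show "H #> x = H #> y" using rcos_eq_iff[OF normal_imp_subgroup[OF nH]] xy by blast
    qed simp
    moreover have "g \<notin> H" using K(3) by (simp add: H)
    ultimately show ?thesis using nH by blast
  qed
  from assms(3,4) have "\<exists>H. H \<lhd> G \<and> M \<subseteq> H \<and> finite_quotient G H (carrier G) \<and> H \<inter> F = {}"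
  proof (induction F)
    case empty
    have "carrier G \<lhd> G" by (rule normal_invI[OF subgroup_self]) auto
    then show ?case using M.subset finite_quotient_self[OF subgroup_self] by blast
  next
    case (insert g F)
    then obtain H H' where H: "H \<lhd> G" "M \<subseteq> H" "finite_quotient G H (carrier G)" "H \<inter> F = {}"
      and H': "H' \<lhd> G" "M \<subseteq> H'" "finite_quotient G H' (carrier G)" "g \<notin> H'"
      using one[of g] by auto
    then have "finite_quotient G (H \<inter> H') (carrier G)"
      by (intro finite_quotient_Int normal_imp_subgroup) auto
    moreover have "H \<inter> H' \<lhd> G" using H H' by (intro normal_subgroup_intersect)
    ultimately show ?case using H H' by blast
  qed
  then show thesis by (elim exE conjE) (rule that)
qed

end

section \<open>Derivatives of the space of normal subgroups\<close>

abbreviation (input) CB_normal :: "('a, 'b) monoid_scheme \<Rightarrow> 'o ordinal \<Rightarrow> 'a set set"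
  where "CB_normal G \<equiv> CB_derivative (normal_subgroup_space G)"

context group
begin

lemma CB_normal_normal: "N \<in> CB_normal G \<alpha> \<Longrightarrow> N \<lhd> G"
  using CB_derivative_subset_topspace[of "normal_subgroup_space G" \<alpha>] by auto

lemma CB_normal_osuc_iff:
  assumes "max_n G"
  shows "M \<in> CB_normal G (osuc \<alpha>) \<longleftrightarrow> M \<in> CB_normal G \<alpha> \<and>
    (\<forall>F. finite F \<and> F \<subseteq> carrier G - M \<longrightarrow> (\<exists>N\<in>CB_normal G \<alpha>. M \<subset> N \<and> N \<inter> F = {}))"
  unfolding CB_derivative_osuc_iff
  using max_n_derived_set_iff[OF assms CB_normal_normal CB_normal_normal] by (rule conj_cong[OF refl])

text \<open>
  Finite normal subgroups of \<open>G/M\<close> all lie in a greatest one \<open>W/M\<close>, so the normal subgroups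
  that are close enough to \<open>M\<close> to meet \<open>W\<close> only in \<open>M\<close> are infinite over \<open>M\<close>.
\<close>

lemma CB_normal_osuc_infinite_quotient:
  assumes "max_n G" "M \<in> CB_normal G (osuc \<alpha>)"
  obtains N where "N \<in> CB_normal G \<alpha>" "M \<subseteq> N" "\<not> finite_quotient G M N"
proof -
  have M: "M \<lhd> G" using assms(2) by (rule CB_normal_normal)
  define \<W> where "\<W> = {W. W \<lhd> G \<and> M \<subseteq> W \<and> finite_quotient G M W}"
  have "M \<in> \<W>" using M by (simp add: \<W>_def finite_quotient_self normal_imp_subgroup)
  then have ne: "\<W> \<noteq> {}" by blast
  have normal: "W \<lhd> G" if "W \<in> \<W>" for W using that by (simp add: \<W>_def)
  obtain W where W: "W \<in> \<W>" and max: "\<And>W'. W' \<in> \<W> \<Longrightarrow> W \<subseteq> W' \<Longrightarrow> W' = W"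
    using max_n_maximal[OF assms(1) ne normal] by metis
  have W': "W \<lhd> G" "M \<subseteq> W" "finite_quotient G M W" using W by (auto simp: \<W>_def)
  obtain R where R: "finite R" "R \<subseteq> carrier G - M"
    "\<And>N. N \<lhd> G \<Longrightarrow> M \<subseteq> N \<Longrightarrow> N \<inter> R = {} \<Longrightarrow> N \<inter> W \<subseteq> M"
    using finite_quotient_transversal[OF W'(3) M normal_subset[OF W'(1)]] by metis
  obtain N where N: "N \<in> CB_normal G \<alpha>" "M \<subset> N" "N \<inter> R = {}"
    using assms(2) R(1,2) unfolding CB_normal_osuc_iff[OF assms(1)] by blast
  have Nn: "N \<lhd> G" using N(1) by (rule CB_normal_normal)
  \<comment> \<open>Otherwise \<open>W <#> N\<close> would again be finite over \<open>M\<close>, so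
    \<open>N \<subseteq> W\<close> by maximality; but \<open>N\<close> avoids \<open>R\<close>,
    which leaves only \<open>N \<subseteq> M\<close>.\<close>
  have "\<not> finite_quotient G M N"
  proof
    assume "finite_quotient G M N"
    then have fq: "finite_quotient G M (W <#> N)"
      using W' M Nn by (intro finite_quotient_set_mult normal_subset)
    have sub: "W \<subseteq> W <#> N" "N \<subseteq> W <#> N"
      using W'(1) Nn by (simp_all add: subset_set_mult normal_imp_subgroup)
    have "W <#> N \<in> \<W>"
      using fq sub W' Nn normal_subgroup_set_mult_closed by (auto simp: \<W>_def)
    with max sub have "N \<subseteq> W" by blast
    with R(3)[OF Nn] N show False by blast
  qed
  with N show thesis by (intro that[of N]) auto
qed

end

section \<open>Derivatives when all quotients are residually finite\<close>

locale max_n_group_with_residually_finite_quotients = group +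
  assumes max_n: "max_n G"
    and rf: "\<And>N. N \<lhd> G \<Longrightarrow> residually_finite (G Mod N)"
begin

text \<open>Take \<open>H\<close> of finite index above \<open>M\<close> avoiding \<open>F\<close>.
  Then \<open>N \<inter> H\<close> has finite index in \<open>N\<close> while \<open>M\<close> has
  not, so the two differ. Downward closure enters as the hypothesis \<open>down\<close> for the
  single stage \<alpha>, so that the induction proving it can use this lemma.\<close>

lemma CB_normal_osucI:
  assumes down: "\<And>N K. N \<in> CB_normal G \<alpha> \<Longrightarrow> K \<lhd> G \<Longrightarrow> K \<subseteq> N \<Longrightarrow> K \<in> CB_normal G \<alpha>"
    and N: "N \<in> CB_normal G \<alpha>" and M: "M \<lhd> G" "M \<subseteq> N" "\<not> finite_quotient G M N"
  shows "M \<in> CB_normal G (osuc \<alpha>)"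
  unfolding CB_normal_osuc_iff[OF max_n]
proof (intro conjI allI impI)
  show "M \<in> CB_normal G \<alpha>" using down N M by blast
  have Nn: "N \<lhd> G" using N by (rule CB_normal_normal)
  fix F assume F: "finite F \<and> F \<subseteq> carrier G - M"
  obtain H where H: "H \<lhd> G" "M \<subseteq> H" "finite_quotient G H (carrier G)" "H \<inter> F = {}"
    by (rule residually_finite_FactGroup_avoid[OF M(1) rf[OF M(1)] conjunct1[OF F] conjunct2[OF F]])
  have NH: "N \<inter> H \<lhd> G" by (rule normal_subgroup_intersect[OF Nn H(1)])
  have "finite_quotient G (N \<inter> H) N"
    using H(3) by (rule finite_quotient_transfer) (use H NH Nn in \<open>auto simp: normal_imp_subgroup normal_subset\<close>)
  with M(3) have "N \<inter> H \<noteq> M" by auto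
  moreover have "N \<inter> H \<in> CB_normal G \<alpha>" using down N NH by blast
  ultimately show "\<exists>K\<in>CB_normal G \<alpha>. M \<subset> K \<and> K \<inter> F = {}"
    using H M by (intro bexI[of _ "N \<inter> H"]) auto
qed

text \<open>At a successor, \<open>N\<close> lies below some \<open>K\<close> of the previous stage
  that is infinite over \<open>N\<close>. This \<open>K\<close> is also infinite over the smaller
  \<open>M\<close>, and so witnesses \<open>M\<close> at the successor.\<close>

lemma CB_normal_downward:
  assumes "N \<in> CB_normal G \<alpha>" "M \<lhd> G" "M \<subseteq> N"
  shows "M \<in> CB_normal G \<alpha>"
  using assms
proof (induction \<alpha> arbitrary: M N rule: less_induct)
  case (less \<alpha>)
  show ?case
  proof (cases \<alpha> rule: ordinal_cases)
    case zero
    with less.prems show ?thesis by simp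
  next
    case (suc \<beta>)
    obtain K where K: "K \<in> CB_normal G \<beta>" "N \<subseteq> K" "\<not> finite_quotient G N K"
      by (rule CB_normal_osuc_infinite_quotient[OF max_n less.prems(1)[unfolded suc]])
    note normal = CB_normal_normal[OF K(1)] CB_normal_normal[OF less.prems(1)] less.prems(2)
    have infinite: "\<not> finite_quotient G M K"
    proof
      assume "finite_quotient G M K"
      then have "finite_quotient G N K"
        by (rule finite_quotient_transfer)
          (use normal less.prems in \<open>auto simp: normal_imp_subgroup normal_subset\<close>)
      with K(3) show False by contradiction
    qed
    have down: "L' \<in> CB_normal G \<beta>" if "L \<in> CB_normal G \<beta>" "L' \<lhd> G" "L' \<subseteq> L" for L L'
      by (rule less.IH[OF _ that]) (simp add: suc less_osuc)
    have "M \<subseteq> K" using less.prems(3) K(2) by (rule order_trans)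
    from CB_normal_osucI[OF down K(1) less.prems(2) this infinite] show ?thesis
      unfolding suc .
  next
    case limit
    with less show ?thesis by auto
  qed
qed

lemma CB_normal_trivial_osuc_iff:
  "{\<one>} \<in> CB_normal G (osuc \<alpha>) \<longleftrightarrow> (\<exists>N\<in>CB_normal G \<alpha>. infinite N)"
proof -
  \<comment> \<open>Cosets of the trivial subgroup are singletons.\<close>
  have iff: "finite_quotient G {\<one>} N \<longleftrightarrow> finite N" if "N \<lhd> G" for N
  proof -
    have "(\<lambda>x. {\<one>} #> x) ` N = (\<lambda>x. {x}) ` N"
      using normal_subset[OF that] by (intro image_cong) (auto simp: r_coset_def)
    then show ?thesis unfolding finite_quotient_def by (simp add: finite_image_iff)
  qed
  show ?thesis
  proof
    assume "{\<one>} \<in> CB_normal G (osuc \<alpha>)"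
    then show "\<exists>N\<in>CB_normal G \<alpha>. infinite N"
      by (rule CB_normal_osuc_infinite_quotient[OF max_n]) (use iff CB_normal_normal in blast)
  next
    assume "\<exists>N\<in>CB_normal G \<alpha>. infinite N"
    then obtain N where N: "N \<in> CB_normal G \<alpha>" "infinite N" by blast
    have Nn: "N \<lhd> G" using N(1) by (rule CB_normal_normal)
    show "{\<one>} \<in> CB_normal G (osuc \<alpha>)"
      using CB_normal_downward N(1) one_is_normal
      by (rule CB_normal_osucI)
        (use N iff[OF Nn] Nn in \<open>auto simp: normal_imp_subgroup subgroup.one_closed\<close>)
  qed
qed

end

section \<open>Quotient groups\<close>

context normal
begin

text \<open>With \<open>image_rcos_Union\<close> below, this makes union and image under the
  quotient map mutually inverse between normal subgroups of \<open>G Mod H\<close> and normal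
  subgroups of \<open>G\<close> containing \<open>H\<close>.\<close>

lemma Union_image_rcos:
  assumes "N \<lhd> G" "H \<subseteq> N"
  shows "\<Union>((\<lambda>x. H #> x) ` N) = N"
proof
  show "N \<subseteq> \<Union>((\<lambda>x. H #> x) ` N)"
    using normal_subset[OF assms(1)] rcos_self[OF _ subgroup_axioms] by blast
  show "\<Union>((\<lambda>x. H #> x) ` N) \<subseteq> N"
    using assms(2) subgroup.m_closed[OF normal_imp_subgroup[OF assms(1)]]
    unfolding r_coset_def by blast
qed

lemma image_rcos_normal:
  assumes "N \<lhd> G"
  shows "(\<lambda>x. H #> x) ` N \<lhd> G Mod H"
proof -
  have "group_hom G (G Mod H) (\<lambda>x. H #> x)"
    by (simp add: group_hom_def group_hom_axioms_def is_group factorgroup_is_group r_coset_hom_Mod)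
  then show ?thesis
    by (rule normal.surj_hom_normal_subgroup[OF assms]) (simp add: carrier_FactGroup)
qed

lemma rcos_mem_iff_mem_Union:
  assumes "K \<lhd> G Mod H" "x \<in> carrier G"
  shows "H #> x \<in> K \<longleftrightarrow> x \<in> \<Union>K"
  using factgroup_subgroup_union_char[OF normal_imp_subgroup[OF assms(1)]] assms(2) by auto

lemma image_rcos_Union:
  assumes "K \<lhd> G Mod H"
  shows "(\<lambda>x. H #> x) ` \<Union>K = K"
  using factgroup_subgroup_union_char[OF normal_imp_subgroup[OF assms]]
    group.normal_subset[OF factorgroup_is_group assms]
  by (auto simp: carrier_FactGroup image_iff)

lemma Union_psubset_iff:
  assumes "K \<lhd> G Mod H" "K' \<lhd> G Mod H"
  shows "\<Union>K \<subset> \<Union>K' \<longleftrightarrow> K \<subset> K'"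
  using image_rcos_Union[OF assms(1)] image_rcos_Union[OF assms(2)]
  by (metis Union_mono image_mono psubset_eq)

lemma max_n_FactGroup:
  assumes "max_n G"
  shows "max_n (G Mod H)"
  unfolding max_n_def
proof
  assume "\<exists>N::nat \<Rightarrow> 'a set set. (\<forall>i. N i \<lhd> G Mod H) \<and> strict_mono N"
  then obtain N :: "nat \<Rightarrow> 'a set set" where N: "\<And>i. N i \<lhd> G Mod H" "strict_mono N" by blast
  then have "strict_mono (\<lambda>i. \<Union>(N i))"
    by (simp add: strict_mono_Suc_iff Union_psubset_iff)
  moreover have "\<forall>i. \<Union>(N i) \<lhd> G" using N(1) factgroup_subgroup_union_normal by blast
  ultimately have "\<exists>M::nat \<Rightarrow> 'a set. (\<forall>i. M i \<lhd> G) \<and> strict_mono M"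
    by (intro exI[of _ "\<lambda>i. \<Union>(N i)"]) simp
  then show False using assms unfolding max_n_def by contradiction
qed

text \<open>By the max-n criterion, accumulation at \<open>\<Union>K\<close> involves only normal
  subgroups above it. These contain \<open>H\<close>, so they correspond to normal subgroups of the
  quotient; finite sets to be avoided pass between elements and cosets.\<close>

lemma CB_derivative_FactGroup_iff:
  assumes "max_n G" "K \<lhd> G Mod H"
  shows "K \<in> CB_derivative (normal_subgroup_space (G Mod H)) \<alpha> \<longleftrightarrow>
    \<Union>K \<in> CB_derivative (normal_subgroup_space G) \<alpha>"
  using assms(2)
proof (induction \<alpha> arbitrary: K rule: less_induct)
  case (less \<alpha>)
  interpret Q: group "G Mod H" by (rule factorgroup_is_group)
  let ?X = "normal_subgroup_space G" and ?Y = "normal_subgroup_space (G Mod H)"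
  have un: "\<Union>L \<lhd> G" if "L \<lhd> G Mod H" for L
    using that by (rule factgroup_subgroup_union_normal)
  show ?case
  proof (cases \<alpha> rule: ordinal_cases)
    case zero
    with less.prems un show ?thesis by simp
  next
    case (suc \<beta>)
    have IH: "L \<in> CB_derivative ?Y \<beta> \<longleftrightarrow> \<Union>L \<in> CB_derivative ?X \<beta>" if "L \<lhd> G Mod H" for L
      using less.IH[of \<beta> L] that by (simp add: suc less_osuc)
    have "(\<forall>F. finite F \<and> F \<subseteq> carrier (G Mod H) - K \<longrightarrow>
        (\<exists>L\<in>CB_derivative ?Y \<beta>. K \<subset> L \<and> L \<inter> F = {})) \<longleftrightarrow>
      (\<forall>F. finite F \<and> F \<subseteq> carrier G - \<Union>K \<longrightarrow>
        (\<exists>N\<in>CB_derivative ?X \<beta>. \<Union>K \<subset> N \<and> N \<inter> F = {}))" (is "?L \<longleftrightarrow> ?R")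
    proof
      assume L: ?L
      show ?R
      proof (intro allI impI)
        fix F assume F: "finite F \<and> F \<subseteq> carrier G - \<Union>K"
        have "(\<lambda>x. H #> x) ` F \<subseteq> carrier (G Mod H) - K"
          using F rcos_mem_iff_mem_Union[OF less.prems] by (auto simp: carrier_FactGroup)
        with L F obtain L where L: "L \<in> CB_derivative ?Y \<beta>" "K \<subset> L" "L \<inter> (\<lambda>x. H #> x) ` F = {}"
          by (meson finite_imageI)
        have n: "L \<lhd> G Mod H" using L(1) by (rule Q.CB_normal_normal)
        have "\<Union>L \<inter> F = {}"
          using L(3) F rcos_mem_iff_mem_Union[OF n] by blast
        moreover have "\<Union>L \<in> CB_derivative ?X \<beta>" using IH[OF n] L(1) by blast
        moreover have "\<Union>K \<subset> \<Union>L" using L(2) Union_psubset_iff[OF less.prems n] by blast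
        ultimately show "\<exists>N\<in>CB_derivative ?X \<beta>. \<Union>K \<subset> N \<and> N \<inter> F = {}" by blast
      qed
    next
      assume R: ?R
      show ?L
      proof (intro allI impI)
        fix F assume F: "finite F \<and> F \<subseteq> carrier (G Mod H) - K"
        \<comment> \<open>\<open>E\<close> is a finite set of representatives of the cosets in
          \<open>F\<close>.\<close>
        then obtain E where E: "E \<subseteq> carrier G" "finite E" "F = (\<lambda>x. H #> x) ` E"
          by (metis Diff_subset carrier_FactGroup finite_subset_image order_trans)
        have EK: "E \<subseteq> carrier G - \<Union>K"
          using E F rcos_mem_iff_mem_Union[OF less.prems] by blast
        obtain N where N: "N \<in> CB_derivative ?X \<beta>" "\<Union>K \<subset> N" "N \<inter> E = {}"
          using R[rule_format, OF conjI[OF E(2) EK]] by blast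
        have Nn: "N \<lhd> G" using N(1) by (rule CB_normal_normal)
        define L where "L = (\<lambda>x. H #> x) ` N"
        have n: "L \<lhd> G Mod H" unfolding L_def by (rule image_rcos_normal[OF Nn])
        \<comment> \<open>\<open>H\<close> is the identity of the quotient group.\<close>
        have "H \<in> K" using subgroup.one_closed[OF normal_imp_subgroup[OF less.prems]] by simp
        then have "H \<subseteq> N" using N(2) by blast
        then have UL: "\<Union>L = N" unfolding L_def by (rule Union_image_rcos[OF Nn])
        have "L \<inter> F = {}"
          using N(3) E rcos_mem_iff_mem_Union[OF n] unfolding UL by blast
        moreover have "L \<in> CB_derivative ?Y \<beta>" using IH[OF n] N(1) UL by simp
        moreover have "K \<subset> L" using N(2) Union_psubset_iff[OF less.prems n] UL by simp
        ultimately show "\<exists>L\<in>CB_derivative ?Y \<beta>. K \<subset> L \<and> L \<inter> F = {}" by blast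
      qed
    qed
    then show ?thesis unfolding suc
      by (simp only: CB_normal_osuc_iff[OF assms(1)]
        Q.CB_normal_osuc_iff[OF max_n_FactGroup[OF assms(1)]] IH[OF less.prems])
  next
    case limit
    with less show ?thesis by auto
  qed
qed

text \<open>The trivial subgroup of the quotient is \<open>{H}\<close>, whose union is
  \<open>H\<close>.\<close>

lemma cb_FactGroup:
  assumes "max_n G"
  shows "cb (G Mod H) = CB_rank (normal_subgroup_space G) H"
proof -
  have "{H} \<lhd> G Mod H"
    using group.one_is_normal[OF factorgroup_is_group] by simp
  then show ?thesis
    by (simp add: cb_def CB_rank_def CB_derivative_FactGroup_iff[OF assms])
qed

end

section \<open>The rank formula\<close>

text \<open>Ranks are taken over \<open>'a set set\<close>, the type of the points of the spaces of
  the quotients. The conjuncts on \<open>NoRank\<close> and boundedness ensure that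
  \<open>the_rank\<close> and the supremum have their intended meaning.\<close>

theorem proposition1p3:
  fixes G :: "('a, 'b) monoid_scheme"
  assumes "group G" and "max_n G"
  shows "scattered_space (normal_subgroup_space G) \<and>
    ((\<forall>N. N \<lhd> G \<longrightarrow> residually_finite (G Mod N)) \<longrightarrow>
      (\<forall>N. N \<lhd> G \<and> infinite N \<longrightarrow> (cb (G Mod N) :: 'a set set CB_value) \<noteq> NoRank) \<and>
      bdd_above ((\<lambda>N. osuc (the_rank (cb (G Mod N) :: 'a set set CB_value))) ` {N. N \<lhd> G \<and> infinite N}) \<and>
      (cb G :: 'a set set CB_value) =
        Rank (SUP N \<in> {N. N \<lhd> G \<and> infinite N}. osuc (the_rank (cb (G Mod N)))))"
proof (intro conjI impI)
  interpret group G by fact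
  let ?X = "normal_subgroup_space G"
  have iso: "\<not> P \<subseteq> ?X derived_set_of P" if "P \<noteq> {}" "P \<subseteq> topspace ?X" for P
    using max_n_isolated[OF assms(2) that] .
  have "\<exists>\<alpha> :: 'a set ordinal. CB_derivative ?X \<alpha> = {}"
    by (rule CB_derivative_eventually_empty[of Inl]) (use iso in auto)
  then show "scattered_space ?X" by (simp add: scattered_space_def)
  have "\<exists>\<gamma> :: 'a set set ordinal. CB_derivative ?X \<gamma> = {}"
    \<comment> \<open>Singletons embed the points of \<open>?X\<close> into the larger type over
      which ranks are measured.\<close>
    by (rule CB_derivative_eventually_empty[of "\<lambda>N. Inl {N}"]) (use iso in \<open>auto simp: inj_def\<close>)
  then obtain \<gamma> :: "'a set set ordinal" where \<gamma>: "CB_derivative ?X \<gamma> = {}" by blast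
  have "\<exists>\<beta>. (CB_rank ?X N :: 'a set set CB_value) = Rank \<beta> \<and> (\<forall>\<alpha>. N \<in> CB_derivative ?X \<alpha> \<longleftrightarrow> \<alpha> \<le> \<beta>)"
    if "N \<lhd> G" for N
    using CB_rank_attained[of N ?X \<gamma>] that \<gamma> by (metis empty_iff mem_Collect_eq topspace_normal_subgroup_space)
  then obtain c :: "'a set \<Rightarrow> 'a set set ordinal"
    where c: "\<And>N. N \<lhd> G \<Longrightarrow> CB_rank ?X N = Rank (c N)"
      "\<And>N \<alpha>. N \<lhd> G \<Longrightarrow> N \<in> CB_derivative ?X \<alpha> \<longleftrightarrow> \<alpha> \<le> c N"
    by metis
  have cbN: "cb (G Mod N) = Rank (c N)" if "N \<lhd> G" for N
    by (simp add: normal.cb_FactGroup[OF that assms(2)] c(1)[OF that])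
  then show "\<forall>N. N \<lhd> G \<and> infinite N \<longrightarrow> (cb (G Mod N) :: 'a set set CB_value) \<noteq> NoRank"
    by simp
  assume rf: "\<forall>N. N \<lhd> G \<longrightarrow> residually_finite (G Mod N)"
  interpret max_n_group_with_residually_finite_quotients G
    by unfold_locales (use assms(2) rf in auto)
  define S where "S = (\<lambda>N. osuc (the_rank (cb (G Mod N) :: 'a set set CB_value))) ` {N. N \<lhd> G \<and> infinite N}"
  have S: "S = (\<lambda>N. osuc (c N)) ` {N. N \<lhd> G \<and> infinite N}"
    unfolding S_def by (intro image_cong) (auto simp: cbN)
  \<comment> \<open>An infinite \<open>N\<close> survives to stage \<open>c N\<close>, which carries
    the trivial subgroup one stage further.\<close>
  have upper: "s \<le> c {\<one>\<^bsub>G\<^esub>}" if "s \<in> S" for s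
  proof -
    obtain N where N: "N \<lhd> G" "infinite N" "s = osuc (c N)" using \<open>s \<in> S\<close> by (auto simp: S)
    then have "N \<in> CB_derivative ?X (c N)" by (simp add: c(2))
    with N(2) have "{\<one>\<^bsub>G\<^esub>} \<in> CB_derivative ?X s"
      unfolding N(3) CB_normal_trivial_osuc_iff by blast
    then show ?thesis by (simp add: c(2) one_is_normal)
  qed
  then show bdd: "bdd_above ((\<lambda>N. osuc (the_rank (cb (G Mod N) :: 'a set set CB_value))) ` {N. N \<lhd> G \<and> infinite N})"
    unfolding S_def[symmetric] by (rule bdd_aboveI)
  \<comment> \<open>Otherwise an infinite \<open>N\<close> survives to stage \<open>Sup S\<close>,
    and \<open>osuc (c N)\<close> is an element of \<open>S\<close> exceeding its supremum.\<close>
  have "c {\<one>\<^bsub>G\<^esub>} \<le> Sup S"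
  proof (rule ccontr)
    assume "\<not> c {\<one>\<^bsub>G\<^esub>} \<le> Sup S"
    then have "{\<one>\<^bsub>G\<^esub>} \<in> CB_derivative ?X (osuc (Sup S))"
      using c(2)[OF one_is_normal] osuc_le by (metis not_le)
    then obtain N where N: "N \<in> CB_derivative ?X (Sup S)" "infinite N"
      unfolding CB_normal_trivial_osuc_iff by blast
    then have "Sup S \<le> c N" "N \<lhd> G" using c(2) CB_normal_normal by blast+
    then have "osuc (c N) \<le> Sup S"
      using N(2) bdd unfolding S_def[symmetric] by (intro cSup_upper) (auto simp: S)
    with \<open>Sup S \<le> c N\<close> show False using less_osuc[of "c N"] by simp
  qed
  moreover have "Sup S \<le> c {\<one>\<^bsub>G\<^esub>}"
    \<comment> \<open>Minimality among upper bounds also covers an empty \<open>S\<close>, where the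
      supremum is \<open>0\<close>.\<close>
    unfolding Sup_ordinal_def by (rule Least_le) (use upper in blast)
  ultimately have "c {\<one>\<^bsub>G\<^esub>} = Sup S" by simp
  then show "(cb G :: 'a set set CB_value) =
      Rank (SUP N \<in> {N. N \<lhd> G \<and> infinite N}. osuc (the_rank (cb (G Mod N))))"
    unfolding cb_def[of G] S_def by (simp add: c(1) one_is_normal)
qed

end
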